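(* Let $q$ be a full conjunctive query without self-joins. Then there exists a family of instances, in which all relations have the same size $M$ in bits (and $m$ in tuples), such that every MPC algorithm that computes $q$ with $p$ servers using a constant number of rounds requires load $\Omega\big(m/p^{1/\rho^*(q)}\big)$, where $\rho^*(q)$ is the fractional edge cover number of $q$.
   Context: Queries. A full conjunctive query without self-joins $q(x_1,\dots,x_k)=S_1(\dots),\dots,S_\ell(\dots)$ is a natural join of relations with distinct names, in which every body variable appears in the head. Fractional edge cover. A fractional edge cover of $q$ assigns a weight $w_j\ge0$ to each atom $S_j$ such that for every variable $x_i$, the sum of the weights of the atoms containing $x_i$ is at least $1$. The fractional edge cover number $\rho^*(q)$ is the minimum of $\sum_j w_j$ over all fractional edge covers. MPC model. There are $p$ servers connected by a complete network of private channels. Computation proceeds in synchronous rounds, each consisting of a communication phase (servers exchange data) and a computation phase (unrestricted local computation). The input is initially partitioned evenly among the $p$ servers, and all input data used in computing the answer must be distributed in some round, i.e. what a server can output is determined by the data it receives. At the end, the union of the outputs of the $p$ servers must be the full set of answers to $q$. The load is the maximum number of bits received by any server during any round. Constants in $\Omega(\cdot)$ may depend on $q$ and on the (constant) number of rounds. *)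

theory Defs
  imports Complex_Main
begin

section \<open>Conjunctive queries\<close>

text \<open>An atom \<open>S(x\<^sub>1, \<dots>, x\<^sub>a)\<close> is the pair of its relation name and its list of variables.\<close>

record ('s, 'x) query =
  head :: "'x list"
  atoms :: "('s \<times> 'x list) list"

text \<open>
  Atoms are required to be non-nullary: a nullary relation has at most one tuple, so it cannot
  have the same size as the other relations.  The last equation combines fullness with the usual
  safety condition that every head variable occurs in the body.
\<close>

definition full_conjunctive_query :: "('s, 'x) query \<Rightarrow> bool" where
  "full_conjunctive_query q \<longleftrightarrow>
     atoms q \<noteq> [] \<and> (\<forall>(S, xs) \<in> set (atoms q). xs \<noteq> []) \<and>
     distinct (head q) \<and> set (head q) = (\<Union>(S, xs) \<in> set (atoms q). set xs)"

definition self_join_free :: "('s, 'x) query \<Rightarrow> bool" where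
  "self_join_free q \<longleftrightarrow> distinct (map fst (atoms q))"

type_synonym 's database = "'s \<Rightarrow> nat list set"

definition database_for :: "('s, 'x) query \<Rightarrow> 's database \<Rightarrow> bool" where
  "database_for q I \<longleftrightarrow>
     (\<forall>(S, xs) \<in> set (atoms q). finite (I S) \<and> (\<forall>t \<in> I S. length t = length xs)) \<and>
     (\<forall>S. S \<notin> fst ` set (atoms q) \<longrightarrow> I S = {})"

definition answers :: "('s, 'x) query \<Rightarrow> 's database \<Rightarrow> nat list set" where
  "answers q I = {map \<alpha> (head q) | \<alpha>. \<forall>(S, xs) \<in> set (atoms q). map \<alpha> xs \<in> I S}"

text \<open>
  The size in bits of a relation of arity \<open>a\<close> with \<open>m\<close> tuples over the domain \<open>{0..<n}\<close> is
  \<open>a \<cdot> m \<cdot> log n\<close>.  The domain is that of the individual relation, and \<open>log n\<close> is rounded up to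
  the number of bits with which all its values can be written: with one \<open>n\<close> for the whole
  database, relations of different arities could never agree in both \<open>m\<close> and the number of bits.
\<close>

definition value_width :: "nat list set \<Rightarrow> nat" where
  "value_width R = (LEAST b. \<forall>t \<in> R. \<forall>v \<in> set t. v < 2 ^ b)"

definition size_in_bits :: "nat \<Rightarrow> nat list set \<Rightarrow> nat" where
  "size_in_bits a R = a * card R * value_width R"


section \<open>Fractional edge covers\<close>

definition fractional_edge_cover :: "('s, 'x) query \<Rightarrow> ('s \<Rightarrow> real) \<Rightarrow> bool" where
  "fractional_edge_cover q w \<longleftrightarrow>
     (\<forall>(S, xs) \<in> set (atoms q). 0 \<le> w S) \<and>
     (\<forall>x \<in> set (head q). 1 \<le> (\<Sum>(S, xs) \<in> {(S, xs) \<in> set (atoms q). x \<in> set xs}. w S))"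

text \<open>The infimum is attained, being the value of a feasible and bounded linear program.\<close>

definition fractional_edge_cover_number :: "('s, 'x) query \<Rightarrow> real" where
  "fractional_edge_cover_number q =
     Inf {(\<Sum>(S, xs) \<in> set (atoms q). w S) | w. fractional_edge_cover q w}"


section \<open>The MPC model\<close>

text \<open>
  The servers are \<open>0, \<dots>, p - 1\<close>.  An initial placement \<open>D\<close> gives server \<open>i\<close> the fragment \<open>D i\<close>.
\<close>

definition even_partition ::
  "('s, 'x) query \<Rightarrow> nat \<Rightarrow> 's database \<Rightarrow> (nat \<Rightarrow> 's database) \<Rightarrow> bool" where
  "even_partition q p I D \<longleftrightarrow>
     (\<forall>S. I S = (\<Union>i<p. D i S)) \<and>
     (\<forall>S. \<forall>i<p. \<forall>j<p. i \<noteq> j \<longrightarrow> D i S \<inter> D j S = {}) \<and>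
     (\<forall>i<p. \<forall>j<p. (\<Sum>S \<in> fst ` set (atoms q). card (D i S))
                 \<le> (\<Sum>S \<in> fst ` set (atoms q). card (D j S)) + 1)"

text \<open>
  \<open>send A k i j X h\<close> is the message from server \<open>i\<close> to server \<open>j\<close> in round \<open>k\<close>, where \<open>X\<close> is the
  initial fragment of \<open>i\<close> and \<open>h\<close> lists the data that \<open>i\<close> received in the rounds before \<open>k\<close>.
  \<open>result A i h\<close> is what server \<open>i\<close> outputs after receiving \<open>h\<close> in the course of all rounds.  It
  does not depend on the initial fragment of \<open>i\<close>; input that a server wants to use for its
  output must be sent (possibly by itself) to it in some round.
\<close>

record 's mpc_algorithm =
  send :: "nat \<Rightarrow> nat \<Rightarrow> nat \<Rightarrow> 's database \<Rightarrow> bool list list \<Rightarrow> bool list"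
  result :: "nat \<Rightarrow> bool list list \<Rightarrow> nat list set"

text \<open>
  The data received by a server in a round is one bit string.  Senders and message boundaries
  are visible to the receiver as far as they can be read off these bits; otherwise the silence
  of a channel would convey information that is not counted in the load.
\<close>

primrec history ::
  "'s mpc_algorithm \<Rightarrow> nat \<Rightarrow> (nat \<Rightarrow> 's database) \<Rightarrow> nat \<Rightarrow> nat \<Rightarrow> bool list list" where
  "history A p D 0 = (\<lambda>j. [])"
| "history A p D (Suc k) =
     (\<lambda>j. history A p D k j @ [concat (map (\<lambda>i. send A k i j (D i) (history A p D k i)) [0..<p])])"

definition received ::
  "'s mpc_algorithm \<Rightarrow> nat \<Rightarrow> (nat \<Rightarrow> 's database) \<Rightarrow> nat \<Rightarrow> nat \<Rightarrow> bool list" where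
  "received A p D k j = last (history A p D (Suc k) j)"

definition load :: "'s mpc_algorithm \<Rightarrow> nat \<Rightarrow> nat \<Rightarrow> (nat \<Rightarrow> 's database) \<Rightarrow> nat" where
  "load A p r D = Max {length (received A p D k j) | k j. k < r \<and> j < p}"

definition computes ::
  "'s mpc_algorithm \<Rightarrow> nat \<Rightarrow> nat \<Rightarrow> ('s, 'x) query \<Rightarrow> 's database \<Rightarrow> (nat \<Rightarrow> 's database) \<Rightarrow> bool"
where
  "computes A p r q I D \<longleftrightarrow> (\<Union>j<p. result A j (history A p D r j)) = answers q I"

end

theory Submission
  imports Defs "HOL-Analysis.Analysis" "HOL-Real_Asymp.Real_Asymp"
begin

text \<open>
  By linear programming duality there is a fractional vertex packing \<open>v\<close> of total weight
  \<open>\<rho>\<^sup>*\<close> (up to a term that costs a constant factor).  Giving variable \<open>x\<close> the domain size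
  \<open>m powr v x\<close> makes every atom have at most \<open>m\<close> possible tuples while the query has about
  \<open>m powr \<rho>\<^sup>*\<close> possible answers.  An instance keeps an arbitrary subset of these tuples and
  replaces the missing ones by padding, so that it carries one bit per possible tuple, and on average
  a constant fraction of the possible answers are present.

  A server that has received \<open>B\<close> bits is in one of \<open>2 ^ B\<close> states.  If it outputs a set of
  answers that involves \<open>k\<close> tuples, then all these tuples must be present in each of the instances
  that lead to its state, which are at most a fraction \<open>2 powr (-k)\<close> of all instances; by the AGM
  bound it outputs at most \<open>k powr \<rho>\<^sup>*\<close> answers.  States with \<open>k > 2 * B\<close> contribute \<open>O(1)\<close> in total, so
  a server outputs \<open>O(B powr \<rho>\<^sup>*)\<close> answers on average, and the \<open>p\<close> servers together must produce
  \<open>\<Omega>(m powr \<rho>\<^sup>*)\<close> of them.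
\<close>

section \<open>The AGM bound\<close>

text \<open>Jensen's inequality for \<open>exp\<close> at the points
  \<open>ln (y i)\<close>.\<close>

lemma weighted_arith_geom_mean:
  fixes a y :: "'i \<Rightarrow> real"
  assumes "finite I" and "\<And>i. i \<in> I \<Longrightarrow> 0 < y i" and "\<And>i. i \<in> I \<Longrightarrow> 0 \<le> a i" and "sum a I = 1"
  shows "(\<Prod>i\<in>I. y i powr a i) \<le> (\<Sum>i\<in>I. a i * y i)"
proof -
  have "I \<noteq> {}"
    using assms(4) by auto
  then have "exp (\<Sum>i\<in>I. a i *\<^sub>R ln (y i)) \<le> (\<Sum>i\<in>I. a i * exp (ln (y i)))"
    by (intro convex_on_sum[OF assms(1) _ exp_convex]) (use assms in auto)
  moreover have "(\<Prod>i\<in>I. y i powr a i) = exp (\<Sum>i\<in>I. a i *\<^sub>R ln (y i))"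
    using assms by (simp add: exp_sum) (intro prod.cong, auto simp: powr_def less_imp_neq[THEN not_sym])
  moreover have "(\<Sum>i\<in>I. a i * exp (ln (y i))) = (\<Sum>i\<in>I. a i * y i)"
    using assms by (intro sum.cong) auto
  ultimately show ?thesis by simp
qed

text \<open>After normalising each \<open>y i\<close> to sum 1, all factors are at most 1, so
  shrinking the exponents to total exactly 1 only increases the products. The weighted means that
  then bound them pointwise sum to 1. Allowing a total above 1 is needed because an edge cover may
  cover a variable more than once.\<close>

lemma generalized_Hoelder:
  fixes y :: "'i \<Rightarrow> 'a \<Rightarrow> real" and w :: "'i \<Rightarrow> real"
  assumes "finite A" and "finite I" and pos: "\<And>i a. i \<in> I \<Longrightarrow> a \<in> A \<Longrightarrow> 0 < y i a"
    and w: "\<And>i. i \<in> I \<Longrightarrow> 0 \<le> w i" and W: "1 \<le> sum w I"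
  shows "(\<Sum>a\<in>A. \<Prod>i\<in>I. y i a powr w i) \<le> (\<Prod>i\<in>I. sum (y i) A powr w i)"
proof (cases "A = {}")
  case True
  then show ?thesis by (simp add: prod_nonneg)
next
  case False
  define Y where "Y i = sum (y i) A" for i
  define W where "W = sum w I"
  have W1: "1 \<le> W" using W by (simp add: W_def)
  have Y: "0 < Y i" if "i \<in> I" for i
    unfolding Y_def using that pos False assms(1) by (intro sum_pos) auto
  have frac: "y i a / Y i \<le> 1" if "i \<in> I" "a \<in> A" for i a
  proof -
    have "y i a \<le> Y i"
      unfolding Y_def using that assms(1) pos by (intro member_le_sum) (auto intro: less_imp_le)
    then show ?thesis using Y[OF that(1)] by simp
  qed
  have "(\<Prod>i\<in>I. (y i a / Y i) powr w i) \<le> (\<Sum>i\<in>I. w i / W * (y i a / Y i))" if a: "a \<in> A" for a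
  proof -
    have "(\<Prod>i\<in>I. (y i a / Y i) powr w i) \<le> (\<Prod>i\<in>I. (y i a / Y i) powr (w i / W))"
    proof (intro prod_mono conjI)
      fix i assume i: "i \<in> I"
      have "w i / W \<le> w i"
        using W1 w[OF i] by (simp add: divide_le_eq mult_left_le_one_le mult_le_cancel_left1)
      then show "(y i a / Y i) powr w i \<le> (y i a / Y i) powr (w i / W)"
        using pos[OF i a] Y[OF i] frac[OF i a] by (intro powr_mono') auto
    qed simp
    also have "\<dots> \<le> (\<Sum>i\<in>I. w i / W * (y i a / Y i))"
      using pos a Y w W1 assms(2)
      by (intro weighted_arith_geom_mean) (auto simp: sum_divide_distrib[symmetric] W_def)
    finally show ?thesis .
  qed
  then have "(\<Sum>a\<in>A. \<Prod>i\<in>I. (y i a / Y i) powr w i) \<le> (\<Sum>a\<in>A. \<Sum>i\<in>I. w i / W * (y i a / Y i))"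
    by (rule sum_mono)
  also have "\<dots> = (\<Sum>i\<in>I. \<Sum>a\<in>A. w i / W * (y i a / Y i))"
    by (rule sum.swap)
  also have "\<dots> = (\<Sum>i\<in>I. w i / W)"
  proof (rule sum.cong)
    fix i assume i: "i \<in> I"
    have "(\<Sum>a\<in>A. w i / W * (y i a / Y i)) = w i / W * (Y i / Y i)"
      unfolding sum_distrib_left[symmetric] sum_divide_distrib[symmetric] by (simp only: Y_def)
    then show "(\<Sum>a\<in>A. w i / W * (y i a / Y i)) = w i / W"
      using Y[OF i] by simp
  qed simp
  also have "\<dots> = 1"
    using W1 by (simp add: sum_divide_distrib[symmetric] W_def)
  finally have *: "(\<Sum>a\<in>A. \<Prod>i\<in>I. (y i a / Y i) powr w i) \<le> 1" .
  have "(\<Sum>a\<in>A. \<Prod>i\<in>I. y i a powr w i)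
      = (\<Sum>a\<in>A. (\<Prod>i\<in>I. Y i powr w i) * (\<Prod>i\<in>I. (y i a / Y i) powr w i))"
  proof (rule sum.cong)
    fix a assume a: "a \<in> A"
    have "y i a powr w i = Y i powr w i * (y i a / Y i) powr w i" if "i \<in> I" for i
      using pos[OF that a] Y[OF that] by (simp add: powr_divide)
    then show "(\<Prod>i\<in>I. y i a powr w i) = (\<Prod>i\<in>I. Y i powr w i) * (\<Prod>i\<in>I. (y i a / Y i) powr w i)"
      by (simp add: prod.distrib)
  qed simp
  also have "\<dots> = (\<Prod>i\<in>I. Y i powr w i) * (\<Sum>a\<in>A. \<Prod>i\<in>I. (y i a / Y i) powr w i)"
    by (simp add: sum_distrib_left)
  also have "\<dots> \<le> (\<Prod>i\<in>I. Y i powr w i) * 1"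
    by (intro mult_left_mono * prod_nonneg) simp
  finally show ?thesis by (simp add: Y_def)
qed

text \<open>Induction on the variables: split \<open>Q\<close> by the value at \<open>x\<close>,
  bound each fibre by induction, and recombine with Hoelder. The separation hypothesis on
  \<open>Q\<close> passes to the fibres, whose members agree at \<open>x\<close>, so the lists
  \<open>e i\<close> need not be shortened when \<open>x\<close> is removed.\<close>

lemma AGM_bound:
  fixes e :: "'i \<Rightarrow> 'x list" and w :: "'i \<Rightarrow> real" and Q :: "('x \<Rightarrow> 'b) set"
  assumes "finite V" and "finite I" and w: "\<And>i. i \<in> I \<Longrightarrow> 0 \<le> w i"
    and cover: "\<And>x. x \<in> V \<Longrightarrow> 1 \<le> (\<Sum>i\<in>{i \<in> I. x \<in> set (e i)}. w i)"
    and "finite Q" and "Q \<noteq> {}" and "\<And>g h. g \<in> Q \<Longrightarrow> h \<in> Q \<Longrightarrow> (\<forall>x\<in>V. g x = h x) \<Longrightarrow> g = h"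
  shows "real (card Q) \<le> (\<Prod>i\<in>I. real (card ((\<lambda>g. map g (e i)) ` Q)) powr w i)"
  using assms(1,5-) cover
proof (induction V arbitrary: Q rule: finite_induct)
  case empty
  then obtain g where "Q = {g}" by blast
  then show ?case by simp
next
  case (insert x V)
  define P where "P i R = real (card ((\<lambda>g. map g (e i)) ` R))" for i and R :: "('x \<Rightarrow> 'b) set"
  define A where "A = (\<lambda>g. g x) ` Q"
  define R where "R a = {g \<in> Q. g x = a}" for a
  have finA: "finite A" using insert by (simp add: A_def)
  have RQ: "R a \<subseteq> Q" and finR: "finite (R a)" for a
    using insert by (auto simp: R_def)
  have neR: "R a \<noteq> {}" if "a \<in> A" for a
    using that by (auto simp: R_def A_def)
  have IH: "real (card (R a)) \<le> (\<Prod>i\<in>I. P i (R a) powr w i)" if "a \<in> A" for a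
    unfolding P_def
  proof (rule insert.IH)
    show "g = h" if "g \<in> R a" "h \<in> R a" "\<forall>y\<in>V. g y = h y" for g h
      using that insert.prems(3)[of g h] by (auto simp: R_def)
  qed (use insert.prems finR neR that in auto)
  have Ppos: "0 < P i (R a)" if "a \<in> A" for i a
    using neR[OF that] finR by (simp add: P_def card_gt_0_iff)
  let ?J = "{i \<in> I. x \<in> set (e i)}" and ?K = "{i \<in> I. x \<notin> set (e i)}"
  have split: "(\<Prod>i\<in>I. f i) = (\<Prod>i\<in>?J. f i) * (\<Prod>i\<in>?K. f i)" for f :: "'i \<Rightarrow> real"
    using assms(2) by (subst prod.union_disjoint[symmetric]) (auto intro!: prod.cong)
  \<comment> \<open>When \<open>x\<close> occurs in \<open>e i\<close>, the projected tuple
    determines the value at \<open>x\<close>, so the projections of different fibres are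
    disjoint.\<close>
  have sumP: "(\<Sum>a\<in>A. P i (R a)) = P i Q" if "i \<in> ?J" for i
  proof -
    have "card ((\<lambda>g. map g (e i)) ` Q) = card (\<Union>a\<in>A. (\<lambda>g. map g (e i)) ` R a)"
      by (rule arg_cong[where f = card]) (auto simp: A_def R_def)
    also have "\<dots> = (\<Sum>a\<in>A. card ((\<lambda>g. map g (e i)) ` R a))"
      using that finA finR by (intro card_UN_disjoint) (auto simp: R_def map_eq_conv)
    finally show ?thesis by (simp add: P_def)
  qed
  have "card Q = card (\<Union>a\<in>A. R a)"
    by (rule arg_cong[where f = card]) (auto simp: A_def R_def)
  also have "\<dots> = (\<Sum>a\<in>A. card (R a))"
    using finA finR by (intro card_UN_disjoint) (auto simp: R_def)
  finally have "real (card Q) = (\<Sum>a\<in>A. real (card (R a)))" by simp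
  also have "\<dots> \<le> (\<Sum>a\<in>A. \<Prod>i\<in>I. P i (R a) powr w i)"
    by (intro sum_mono IH)
  \<comment> \<open>Atoms without \<open>x\<close> do not see the split; their fibre projections are
    bounded by the whole projection, which factors out of the sum.\<close>
  also have "\<dots> \<le> (\<Sum>a\<in>A. (\<Prod>i\<in>?J. P i (R a) powr w i) * (\<Prod>i\<in>?K. P i Q powr w i))"
    unfolding split
  proof (intro sum_mono mult_left_mono prod_mono prod_nonneg conjI powr_mono2)
    show "P i (R a) \<le> P i Q" for i a
      unfolding P_def using insert.prems(1) RQ[of a] by (auto intro!: card_mono)
  qed (use w Ppos in \<open>auto simp: P_def\<close>)
  also have "\<dots> = (\<Sum>a\<in>A. \<Prod>i\<in>?J. P i (R a) powr w i) * (\<Prod>i\<in>?K. P i Q powr w i)"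
    by (simp add: sum_distrib_right)
  \<comment> \<open>The atoms that remain inside the sum are those containing \<open>x\<close>, and
    the cover condition at \<open>x\<close> is the weight hypothesis of Hoelder.\<close>
  also have "\<dots> \<le> (\<Prod>i\<in>?J. (\<Sum>a\<in>A. P i (R a)) powr w i) * (\<Prod>i\<in>?K. P i Q powr w i)"
    using w assms(2) finA Ppos insert.prems(4)[of x]
    by (intro mult_right_mono generalized_Hoelder prod_nonneg) auto
  also have "\<dots> = (\<Prod>i\<in>I. P i Q powr w i)"
    unfolding split using sumP by simp
  finally show ?case by (simp add: P_def)
qed

section \<open>Fractional packings and covers\<close>

text \<open>Replaces a truncated square at a moved point by a polynomial quadratic in the step, so
  that the optimality argument below needs no derivative.\<close>

lemma max_0_diff_power2_le:
  fixes a d :: real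
  shows "(max 0 (a - d))\<^sup>2 \<le> (max 0 a - d)\<^sup>2"
proof (cases "0 \<le> a - d")
  case True
  then show ?thesis by (cases "0 \<le> a") (auto simp: abs_le_square_iff[symmetric])
qed (simp add: max_def)

text \<open>The hard half of linear programming duality. Among weightings of total at most
  \<open>\<rho>\<close>, take one minimising the sum of the squared shortfalls of the variables. Its
  shortfall vector \<open>u\<close> is nonzero, since no cover is that cheap, and first-order
  optimality makes \<open>u\<close>, scaled to total \<open>\<rho>\<close>, a packing.\<close>

lemma fractional_packing_exists:
  fixes e :: "'i \<Rightarrow> 'x set" and \<rho> :: real
  assumes fin: "finite V" "finite I" and "0 < \<rho>"
    and no_cover: "\<And>w. (\<And>i. 0 \<le> w i) \<Longrightarrow> sum w I \<le> \<rho> \<Longrightarrow> \<exists>x\<in>V. (\<Sum>i\<in>{i \<in> I. x \<in> e i}. w i) < 1"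
  shows "\<exists>v. (\<forall>x\<in>V. 0 \<le> v x) \<and> (\<forall>i\<in>I. (\<Sum>x\<in>{x \<in> V. x \<in> e i}. v x) \<le> 1) \<and> sum v V = \<rho>"
proof -
  define c where "c w x = (\<Sum>i\<in>{i \<in> I. x \<in> e i}. w i)" for w :: "'i \<Rightarrow> real" and x
  \<comment> \<open>Weights outside \<open>I\<close> are pinned to 0, which makes the set compact in
    the product topology on all functions.\<close>
  define K where "K = PiE UNIV (\<lambda>i. if i \<in> I then {0..\<rho>} else {0}) \<inter> {w. sum w I \<le> \<rho>}"
  define F where "F w = (\<Sum>x\<in>V. (max 0 (1 - c w x))\<^sup>2)" for w
  have coord: "continuous_on S (\<lambda>w. w i)" for i and S :: "('i \<Rightarrow> real) set"
    by (rule continuous_on_subset[OF continuous_on_product_coordinates]) simp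
  have "compact (PiE UNIV (\<lambda>i. if i \<in> I then {0..\<rho>} else {0}))"
    using compactin_PiE[of "\<lambda>_. euclidean" UNIV "\<lambda>i. if i \<in> I then {0..\<rho>} else {0}"]
    unfolding euclidean_product_topology by simp
  moreover have "closed {w :: 'i \<Rightarrow> real. sum w I \<le> \<rho>}"
    by (intro closed_Collect_le continuous_intros coord)
  ultimately have "compact K"
    unfolding K_def by (rule compact_Int_closed)
  moreover have "(\<lambda>_. 0) \<in> K"
    using \<open>0 < \<rho>\<close> by (auto simp: K_def)
  moreover have "continuous_on K F"
    unfolding F_def c_def by (intro continuous_intros coord)
  ultimately obtain w where w: "w \<in> K" and min: "\<And>w'. w' \<in> K \<Longrightarrow> F w \<le> F w'"
    using continuous_attains_inf[of K F] by blast
  define u where "u x = max 0 (1 - c w x)" for x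
  have u0: "0 \<le> u x" for x by (simp add: u_def)
  have w0: "0 \<le> w i" for i
    using w by (auto simp: K_def PiE_iff split: if_splits dest!: spec[of _ i])
  obtain x0 where "x0 \<in> V" "c w x0 < 1"
    using no_cover[of w] w w0 by (auto simp: K_def c_def)
  then have U: "0 < sum u V"
    using fin u0 by (intro sum_pos2[of _ x0]) (auto simp: u_def)
  have convex: "(\<lambda>i. w i + t * (w' i - w i)) \<in> K" if "w' \<in> K" "0 \<le> t" "t \<le> 1" for w' t
  proof -
    have *: "w i + t * (w' i - w i) = (1 - t) * w i + t * w' i" for i
      by (simp add: algebra_simps)
    have "(1 - t) * w i + t * w' i \<in> (if i \<in> I then {0..\<rho>} else {0})" for i
      using convexD[of "if i \<in> I then {0..\<rho>} else {0}" "w i" "w' i" "1 - t" t] w that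
      by (auto simp: K_def PiE_iff)
    moreover have "(1 - t) * sum w I + t * sum w' I \<le> \<rho>"
      using w that by (intro convex_bound_le) (auto simp: K_def)
    ultimately show ?thesis
      by (simp add: K_def PiE_iff * sum.distrib sum_distrib_left)
  qed
  text \<open>First-order optimality of \<open>w\<close>: the gradient of \<open>F\<close> at \<open>w\<close> is \<open>-2u\<close> along \<open>c\<close>.\<close>
  have opt: "(\<Sum>x\<in>V. u x * c w' x) \<le> (\<Sum>x\<in>V. u x * c w x)" if w': "w' \<in> K" for w'
  proof (rule ccontr)
    define d where "d x = c w' x - c w x" for x
    define a where "a = (\<Sum>x\<in>V. u x * d x)"
    define b where "b = (\<Sum>x\<in>V. (d x)\<^sup>2)"
    assume "\<not> ?thesis"
    then have a: "0 < a"
      by (simp add: a_def d_def algebra_simps sum_subtractf)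
    have b: "0 \<le> b" by (simp add: b_def sum_nonneg)
    \<comment> \<open>This step length keeps the quadratic term \<open>t * (t * b)\<close> below
      half of the linear gain \<open>2 * t * a\<close>; the \<open>+ 1\<close> avoids division by
      zero.\<close>
    define t where "t = min 1 (a / (b + 1))"
    have t: "0 < t" "t \<le> 1" using a b by (auto simp: t_def)
    have "t * b \<le> a / (b + 1) * b"
      using b by (intro mult_right_mono) (auto simp: t_def)
    also have "\<dots> \<le> a"
      using a b by (simp add: field_simps)
    finally have "t * b \<le> a" .
    have "c (\<lambda>i. w i + t * (w' i - w i)) x = c w x + t * d x" for x
      by (simp add: c_def d_def sum.distrib sum_distrib_left sum_subtractf right_diff_distrib)
    then have "F (\<lambda>i. w i + t * (w' i - w i)) = (\<Sum>x\<in>V. (max 0 ((1 - c w x) - t * d x))\<^sup>2)"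
      by (simp add: F_def algebra_simps)
    also have "\<dots> \<le> (\<Sum>x\<in>V. (u x - t * d x)\<^sup>2)"
      unfolding u_def by (intro sum_mono max_0_diff_power2_le)
    also have "\<dots> = F w - 2 * t * a + t * (t * b)"
      by (simp add: F_def u_def a_def b_def power2_diff sum.distrib sum_subtractf sum_distrib_left
          power_mult_distrib algebra_simps power2_eq_square)
    also have "\<dots> \<le> F w - 2 * t * a + t * a"
      using t \<open>t * b \<le> a\<close> by simp
    also have "\<dots> < F w"
      using t a by simp
    finally show False
      using min[OF convex[OF w', of t]] t by simp
  qed
  \<comment> \<open>The shortfall \<open>u x\<close> vanishes wherever \<open>c w x\<close> is at
    least 1.\<close>
  have "(\<Sum>x\<in>V. u x * c w x) \<le> sum u V"
  proof (rule sum_mono)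
    show "u x * c w x \<le> u x" for x
      using mult_left_mono[of "c w x" 1 "1 - c w x"] by (cases "c w x \<le> 1") (auto simp: u_def)
  qed
  define v where "v x = \<rho> * u x / sum u V" for x
  have "(\<Sum>x\<in>{x \<in> V. x \<in> e i}. v x) \<le> 1" if i: "i \<in> I" for i
  proof -
    \<comment> \<open>Spending the whole budget on the single edge \<open>i\<close> turns the
      optimality inequality into the packing constraint of \<open>i\<close>.\<close>
    define w' where "w' = (\<lambda>j. if j = i then \<rho> else 0)"
    have "w' \<in> K"
      using i fin \<open>0 < \<rho>\<close> by (auto simp: K_def w'_def)
    have c': "c w' x = (if x \<in> e i then \<rho> else 0)" for x
      using i fin by (auto simp: c_def w'_def)
    have "\<rho> * (\<Sum>x\<in>{x \<in> V. x \<in> e i}. u x) = (\<Sum>x\<in>V. u x * c w' x)"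
      unfolding c' using fin
      by (simp add: sum_distrib_left sum.inter_filter if_distrib mult.commute cong: if_cong)
    also have "\<dots> \<le> sum u V"
      using opt[OF \<open>w' \<in> K\<close>] \<open>(\<Sum>x\<in>V. u x * c w x) \<le> sum u V\<close> by linarith
    finally show ?thesis
      using U by (simp add: v_def sum_divide_distrib[symmetric] sum_distrib_left[symmetric])
  qed
  moreover have "\<forall>x\<in>V. 0 \<le> v x"
    using u0 U \<open>0 < \<rho>\<close> by (simp add: v_def)
  moreover have "sum v V = \<rho>"
    using U by (simp add: v_def sum_divide_distrib[symmetric] sum_distrib_left[symmetric])
  ultimately show ?thesis by blast
qed

section \<open>Edge cover numbers and the sizes of the grid\<close>

lemma fractional_edge_cover_1:
  assumes "full_conjunctive_query q"
  shows "fractional_edge_cover q (\<lambda>_. 1)"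
  unfolding fractional_edge_cover_def
proof (intro conjI ballI)
  fix x assume "x \<in> set (head q)"
  then have "{(S, xs) \<in> set (atoms q). x \<in> set xs} \<noteq> {}"
    using assms by (auto simp: full_conjunctive_query_def)
  moreover have "finite {(S, xs) \<in> set (atoms q). x \<in> set xs}"
    by (rule finite_subset[of _ "set (atoms q)"]) auto
  ultimately have "1 \<le> card {(S, xs) \<in> set (atoms q). x \<in> set xs}"
    by (simp add: Suc_le_eq card_gt_0_iff)
  then show "1 \<le> (\<Sum>(S, xs)\<in>{(S, xs) \<in> set (atoms q). x \<in> set xs}. 1::real)"
    by (simp add: case_prod_unfold)
qed auto

text \<open>Covering any one variable already costs 1. This bounds the set under \<open>Inf\<close>
  from below and later makes the exponent at least 1.\<close>

lemma fractional_edge_cover_ge_1: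
  assumes "full_conjunctive_query q" and w: "fractional_edge_cover q w"
  shows "1 \<le> (\<Sum>(S, xs)\<in>set (atoms q). w S)"
proof -
  obtain S xs where "(S, xs) \<in> set (atoms q)"
    using assms(1) by (metis full_conjunctive_query_def ex_in_conv set_empty surj_pair)
  moreover from this have "xs \<noteq> []" "set xs \<subseteq> set (head q)"
    using assms(1) by (auto simp: full_conjunctive_query_def)
  ultimately obtain x where "x \<in> set (head q)"
    by (metis ex_in_conv set_empty subset_empty)
  then have "1 \<le> (\<Sum>(S, xs)\<in>{(S, xs) \<in> set (atoms q). x \<in> set xs}. w S)"
    using w by (auto simp: fractional_edge_cover_def)
  also have "\<dots> \<le> (\<Sum>(S, xs)\<in>set (atoms q). w S)"
    using w by (intro sum_mono2) (auto simp: fractional_edge_cover_def)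
  finally show ?thesis .
qed

lemma fractional_edge_cover_number_le:
  assumes "full_conjunctive_query q" and "fractional_edge_cover q w"
  shows "fractional_edge_cover_number q \<le> (\<Sum>(S, xs)\<in>set (atoms q). w S)"
  unfolding fractional_edge_cover_number_def
proof (rule cInf_lower)
  show "bdd_below {(\<Sum>(S, xs)\<in>set (atoms q). w S) | w. fractional_edge_cover q w}"
    using fractional_edge_cover_ge_1[OF assms(1)] by (intro bdd_belowI[of _ 1]) blast
qed (use assms in blast)

lemma fractional_edge_cover_number_ge_1:
  assumes "full_conjunctive_query q"
  shows "1 \<le> fractional_edge_cover_number q"
  unfolding fractional_edge_cover_number_def
proof (rule cInf_greatest)
  show "1 \<le> y" if "y \<in> {(\<Sum>(S, xs)\<in>set (atoms q). w S) | w. fractional_edge_cover q w}" for y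
    using that fractional_edge_cover_ge_1[OF assms] by blast
qed (use fractional_edge_cover_1[OF assms] in blast)

text \<open>Round down \<open>k powr v x\<close> for a packing \<open>v\<close>. The packing
  constraint of an atom bounds its number of possible tuples, while the total weight of
  \<open>v\<close> yields many possible answers. The leading 2 pays for a packing slightly lighter
  than the cover number, and each further 2 pays for rounding at one variable.\<close>

lemma grid_sizes_exist:
  fixes q :: "('s, 'x) query" and k :: nat
  assumes full: "full_conjunctive_query q" and sjf: "self_join_free q" and k: "3 \<le> k"
  shows "\<exists>n. (\<forall>x\<in>set (head q). n x \<le> k) \<and> (\<forall>(S, xs)\<in>set (atoms q). (\<Prod>x\<in>set xs. n x) \<le> k) \<and>
    real k powr fractional_edge_cover_number q
      \<le> 2 * 2 ^ card (set (head q)) * real (\<Prod>x\<in>set (head q). n x)"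
proof -
  \<comment> \<open>A weight strictly below the infimum is reached by no cover, so attainment of the
    infimum is not at issue. The deficit \<open>log k 2\<close> costs exactly a factor 2, and
    \<open>3 \<le> k\<close> keeps the weight positive.\<close>
  define \<rho> where "\<rho> = fractional_edge_cover_number q - log k 2"
  have "log k 2 < 1" "0 < log k 2"
    using k by (auto simp: log_less_one_cancel_iff)
  then have \<rho>: "0 < \<rho>" "\<rho> < fractional_edge_cover_number q"
    using fractional_edge_cover_number_ge_1[OF full] by (auto simp: \<rho>_def)
  have "\<exists>v. (\<forall>x\<in>set (head q). 0 \<le> v x) \<and>
      (\<forall>i\<in>set (atoms q). (\<Sum>x\<in>{x \<in> set (head q). x \<in> set (snd i)}. v x) \<le> 1) \<and> sum v (set (head q)) = \<rho>"
  proof (rule fractional_packing_exists)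
    fix w :: "'s \<times> 'x list \<Rightarrow> real"
    assume w: "\<And>i. 0 \<le> w i" "sum w (set (atoms q)) \<le> \<rho>"
    \<comment> \<open>Duality weighs atoms, covers weigh names; without self-joins a name identifies
      its atom.\<close>
    define w' where "w' S = w (S, the (map_of (atoms q) S))" for S
    have w': "w' S = w (S, xs)" if "(S, xs) \<in> set (atoms q)" for S xs
      using that sjf by (simp add: w'_def self_join_free_def)
    have "\<not> fractional_edge_cover q w'"
    proof
      assume "fractional_edge_cover q w'"
      then have "fractional_edge_cover_number q \<le> (\<Sum>(S, xs)\<in>set (atoms q). w' S)"
        by (rule fractional_edge_cover_number_le[OF full])
      also have "\<dots> = sum w (set (atoms q))"
        using w' by (intro sum.cong) auto
      finally show False using w(2) \<rho>(2) by simp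
    qed
    then obtain x where x: "x \<in> set (head q)"
        "(\<Sum>(S, xs)\<in>{(S, xs) \<in> set (atoms q). x \<in> set xs}. w' S) < 1"
      using w(1) by (auto simp: fractional_edge_cover_def w'_def not_le)
    have "(\<Sum>(S, xs)\<in>{(S, xs) \<in> set (atoms q). x \<in> set xs}. w' S)
        = (\<Sum>i\<in>{i \<in> set (atoms q). x \<in> set (snd i)}. w i)"
      using w' by (intro sum.cong) auto
    then show "\<exists>x\<in>set (head q). (\<Sum>i\<in>{i \<in> set (atoms q). x \<in> set (snd i)}. w i) < 1"
      using x by auto
  qed (use \<rho> in auto)
  then obtain v where v0: "\<And>x. x \<in> set (head q) \<Longrightarrow> 0 \<le> v x"
    and pack: "\<And>S xs. (S, xs) \<in> set (atoms q) \<Longrightarrow> (\<Sum>x\<in>{x \<in> set (head q). x \<in> set xs}. v x) \<le> 1"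
    and sumv: "sum v (set (head q)) = \<rho>"
    by (metis snd_conv)
  define n where "n x = nat \<lfloor>real k powr v x\<rfloor>" for x
  have n_le: "real (n x) \<le> real k powr v x" for x
    by (simp add: n_def)
  \<comment> \<open>Arbitrary subsets of an atom's variables are allowed so that a singleton gives
    the bound on one \<open>n x\<close>.\<close>
  have prod_le: "(\<Prod>x\<in>X. n x) \<le> k" if "(S, xs) \<in> set (atoms q)" "X \<subseteq> set xs" for S xs X
  proof -
    have vars: "set xs \<subseteq> set (head q)"
      using full that by (auto simp: full_conjunctive_query_def)
    have "sum v X \<le> (\<Sum>x\<in>{x \<in> set (head q). x \<in> set xs}. v x)"
      using that vars v0 by (intro sum_mono2) auto
    then have "sum v X \<le> 1"
      using pack[OF that(1)] by simp
    have "real (\<Prod>x\<in>X. n x) \<le> (\<Prod>x\<in>X. real k powr v x)"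
      by (simp add: n_le prod_mono)
    also have "\<dots> = real k powr sum v X"
      using k that(2) finite_subset by (subst powr_sum) auto
    also have "\<dots> \<le> real k"
      using powr_mono[OF \<open>sum v X \<le> 1\<close>, of "real k"] k by simp
    finally show ?thesis by (simp only: of_nat_le_iff)
  qed
  have "n x \<le> k" if "x \<in> set (head q)" for x
  proof -
    have "x \<in> (\<Union>(S, xs)\<in>set (atoms q). set xs)"
      using full that by (simp add: full_conjunctive_query_def)
    then obtain S xs where "(S, xs) \<in> set (atoms q)" "x \<in> set xs"
      by auto
    then show ?thesis
      using prod_le[of S xs "{x}"] by simp
  qed
  moreover have "real k powr fractional_edge_cover_number q
      \<le> 2 * 2 ^ card (set (head q)) * real (\<Prod>x\<in>set (head q). n x)"
  proof -
    \<comment> \<open>Rounding down a number that is at least 1 loses at most a factor 2.\<close>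
    have half: "real k powr v x \<le> 2 * real (n x)" if "x \<in> set (head q)" for x
    proof -
      have "1 \<le> real k powr v x"
        using v0[OF that] k by (simp add: ge_one_powr_ge_zero)
      then have "1 \<le> \<lfloor>real k powr v x\<rfloor>" "real (n x) = of_int \<lfloor>real k powr v x\<rfloor>"
        by (simp_all add: n_def)
      then show ?thesis
        by linarith
    qed
    have "real k powr fractional_edge_cover_number q = 2 * real k powr \<rho>"
      using k by (simp add: \<rho>_def powr_diff)
    also have "real k powr \<rho> = (\<Prod>x\<in>set (head q). real k powr v x)"
      using k by (simp add: powr_sum flip: sumv)
    also have "\<dots> \<le> (\<Prod>x\<in>set (head q). 2 * real (n x))"
      using half by (intro prod_mono) auto
    also have "\<dots> = 2 ^ card (set (head q)) * real (\<Prod>x\<in>set (head q). n x)"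
      by (simp add: prod.distrib)
    finally show ?thesis by simp
  qed
  ultimately show ?thesis
    using prod_le by (intro exI[of _ n]) blast
qed

section \<open>Counting the correct outputs of servers\<close>

text \<open>In \<open>total_output_le\<close> a state that certifies \<open>k\<close> facts has a
  share of at most \<open>2 powr (-k)\<close> of the instances. Half of this decay absorbs the
  polynomial number of outputs; the other half pays for the number of states.\<close>

lemma powr_le_exponential:
  fixes \<rho> :: real
  assumes "0 < \<rho>"
  shows "\<exists>C>0. \<forall>k::nat. real k powr \<rho> \<le> C * 2 powr (real k / 2)"
proof -
  have "(\<lambda>k::nat. real k powr \<rho> / 2 powr (real k / 2)) \<longlonglongrightarrow> 0"
    using assms by real_asymp
  then have "Bseq (\<lambda>k::nat. real k powr \<rho> / 2 powr (real k / 2))"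
    by (intro convergent_imp_Bseq) (auto simp: convergent_def)
  then obtain C where "0 < C" "\<And>k::nat. norm (real k powr \<rho> / 2 powr (real k / 2)) \<le> C"
    unfolding Bseq_def by blast
  then show ?thesis
    by (intro exI[of _ C]) (auto simp: divide_le_eq)
qed

lemma card_supersets:
  assumes "finite T" and "Z \<subseteq> T"
  shows "card {b \<in> Pow T. Z \<subseteq> b} = 2 ^ (card T - card Z)"
proof -
  have "{b \<in> Pow T. Z \<subseteq> b} = (\<lambda>c. c \<union> Z) ` Pow (T - Z)"
  proof (intro equalityI subsetI)
    fix b assume "b \<in> {b \<in> Pow T. Z \<subseteq> b}"
    then show "b \<in> (\<lambda>c. c \<union> Z) ` Pow (T - Z)"
      by (intro image_eqI[of _ _ "b - Z"]) auto
  qed (use assms in auto)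
  moreover have "inj_on (\<lambda>c. c \<union> Z) (Pow (T - Z))"
    by (rule inj_onI) blast
  ultimately show ?thesis
    using assms by (simp add: card_image card_Pow card_Diff_subset finite_subset[OF assms(2)])
qed

text \<open>Here \<open>T\<close> is the set of possible facts, a subset \<open>b\<close> is an
  instance, and \<open>N g\<close> contains the facts needed for the answer \<open>g\<close>.
  Instances are grouped by the state they lead to. A state either certifies few facts, hence few
  answers by \<open>size\<close>, or is reached by few instances.\<close>

lemma total_output_le:
  fixes N :: "'g \<Rightarrow> 't set" and hist :: "'t set \<Rightarrow> 'h" and out :: "'h \<Rightarrow> 'g set"
  assumes "finite T" and "0 < C" and "0 \<le> \<rho>"
    and C: "\<And>k::nat. real k powr \<rho> \<le> C * 2 powr (real k / 2)"
    and hist: "card (hist ` Pow T) \<le> 2 ^ B"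
    and out: "\<And>h. out h \<subseteq> G"
    and sound: "\<And>b g. b \<subseteq> T \<Longrightarrow> g \<in> out (hist b) \<Longrightarrow> N g \<subseteq> b"
    and size: "\<And>Q. Q \<subseteq> G \<Longrightarrow> real (card Q) \<le> real (card (\<Union>g\<in>Q. N g)) powr \<rho>"
  shows "(\<Sum>b\<in>Pow T. real (card (out (hist b)))) \<le> 2 ^ card T * (real (2 * B) powr \<rho> + C)"
proof -
  define n where "n h = card {b \<in> Pow T. hist b = h}" for h
  define X where "X = real (2 * B) powr \<rho>"
  \<comment> \<open>Adding the bounds of both cases allows summation over \<open>h\<close>: the
    numbers \<open>n h\<close> add up to \<open>2 ^ card T\<close>, and the second summand occurs at
    most \<open>2 ^ B\<close> times.\<close>
  have bound: "real (n h) * real (card (out h)) \<le> real (n h) * X + C * 2 powr (real (card T) - real B)"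
    if h: "h \<in> hist ` Pow T" for h
  proof -
    define Z where "Z = (\<Union>g\<in>out h. N g)"
    have sub: "{b \<in> Pow T. hist b = h} \<subseteq> {b \<in> Pow T. Z \<subseteq> b}"
      using sound by (auto simp: Z_def)
    \<comment> \<open>Some instance leads to \<open>h\<close>, and it contains
      \<open>Z\<close>.\<close>
    then have "Z \<subseteq> T"
      using h by blast
    then have ZT: "card Z \<le> card T"
      using assms(1) by (rule card_mono[rotated])
    have out_le: "real (card (out h)) \<le> real (card Z) powr \<rho>"
      using size[OF out] by (simp add: Z_def)
    show ?thesis
    proof (cases "card Z \<le> 2 * B")
      case True
      have "real (card Z) powr \<rho> \<le> X"
        unfolding X_def using True \<open>0 \<le> \<rho>\<close> by (intro powr_mono2) auto
      then have "real (n h) * real (card (out h)) \<le> real (n h) * X"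
        using out_le by (intro mult_left_mono) auto
      also have "\<dots> \<le> real (n h) * X + C * 2 powr (real (card T) - real B)"
        using \<open>0 < C\<close> by simp
      finally show ?thesis .
    next
      case False
      have "n h \<le> 2 ^ (card T - card Z)"
        unfolding n_def card_supersets[OF assms(1) \<open>Z \<subseteq> T\<close>, symmetric]
        using sub assms(1) by (intro card_mono) auto
      then have "real (n h) \<le> 2 ^ (card T - card Z)"
        by (metis of_nat_le_iff of_nat_numeral of_nat_power)
      also have "\<dots> = 2 powr (real (card T) - real (card Z))"
        using ZT by (simp add: powr_realpow[symmetric] of_nat_diff)
      finally have "real (n h) * real (card (out h))
          \<le> 2 powr (real (card T) - real (card Z)) * (C * 2 powr (real (card Z) / 2))"
        using out_le C[of "card Z"] by (intro mult_mono) auto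
      also have "\<dots> = C * 2 powr (real (card T) - real (card Z) / 2)"
        by (simp add: powr_add[symmetric])
      also have "\<dots> \<le> C * 2 powr (real (card T) - real B)"
        using False \<open>0 < C\<close> by (intro mult_left_mono powr_mono) auto
      also have "\<dots> \<le> real (n h) * X + C * 2 powr (real (card T) - real B)"
        by (simp add: X_def)
      finally show ?thesis .
    qed
  qed
  have finP: "finite (Pow T)" using assms(1) by simp
  have "(\<Sum>b\<in>Pow T. real (card (out (hist b))))
      = (\<Sum>h\<in>hist ` Pow T. \<Sum>b\<in>{b \<in> Pow T. hist b = h}. real (card (out (hist b))))"
    by (rule sum.image_gen[OF finP])
  also have "\<dots> = (\<Sum>h\<in>hist ` Pow T. real (n h) * real (card (out h)))"
    by (intro sum.cong) (auto simp: n_def)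
  also have "\<dots> \<le> (\<Sum>h\<in>hist ` Pow T. real (n h) * X + C * 2 powr (real (card T) - real B))"
    by (intro sum_mono bound)
  also have "\<dots> = (\<Sum>h\<in>hist ` Pow T. real (n h)) * X
      + real (card (hist ` Pow T)) * (C * 2 powr (real (card T) - real B))"
    by (simp add: sum.distrib sum_distrib_right)
  also have "(\<Sum>h\<in>hist ` Pow T. real (n h)) = (\<Sum>b\<in>Pow T. 1)"
    using sum.image_gen[OF finP, of "\<lambda>_. 1::real" hist] by (simp add: n_def)
  also have "\<dots> = 2 ^ card T"
    using assms(1) by (simp add: card_Pow)
  also have "real (card (hist ` Pow T)) * (C * 2 powr (real (card T) - real B))
      \<le> 2 ^ B * (C * 2 powr (real (card T) - real B))"
    using of_nat_mono[OF hist, where 'a = real] \<open>0 < C\<close> by (intro mult_right_mono) simp_all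
  also have "2 ^ B * (C * 2 powr (real (card T) - real B)) = C * 2 ^ card T"
    by (simp add: powr_diff powr_realpow)
  finally show ?thesis
    by (simp add: X_def algebra_simps)
qed

text \<open>Double counting of pairs of an instance and an answer present in it. An answer needs at
  most \<open>l\<close> facts, so it is present in at least a fraction \<open>1 / 2 ^ l\<close> of
  the instances; conversely each present answer is output by one of the \<open>p\<close>
  servers.\<close>

lemma distributed_output_bound:
  fixes N :: "'g \<Rightarrow> 't set" and hist :: "nat \<Rightarrow> 't set \<Rightarrow> 'h" and out :: "nat \<Rightarrow> 'h \<Rightarrow> 'g set"
  assumes "finite T" and "finite G" and "0 < C" and "0 \<le> \<rho>"
    and C: "\<And>k::nat. real k powr \<rho> \<le> C * 2 powr (real k / 2)"
    and N: "\<And>g. g \<in> G \<Longrightarrow> N g \<subseteq> T \<and> card (N g) \<le> l"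
    and hist: "\<And>j. j < p \<Longrightarrow> card (hist j ` Pow T) \<le> 2 ^ B"
    and out: "\<And>j h. out j h \<subseteq> G"
    and correct: "\<And>b. b \<subseteq> T \<Longrightarrow> (\<Union>j<p. out j (hist j b)) = {g \<in> G. N g \<subseteq> b}"
    and size: "\<And>Q. Q \<subseteq> G \<Longrightarrow> real (card Q) \<le> real (card (\<Union>g\<in>Q. N g)) powr \<rho>"
  shows "real (card G) \<le> 2 ^ l * real p * (real (2 * B) powr \<rho> + C)"
proof -
  have "real (card G) * 2 ^ card T \<le> (\<Sum>g\<in>G. 2 ^ l * real (card {b \<in> Pow T. N g \<subseteq> b}))"
  proof -
    have "2 ^ card T \<le> 2 ^ l * real (card {b \<in> Pow T. N g \<subseteq> b})" if "g \<in> G" for g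
    proof -
      have "card T \<le> l + (card T - card (N g))"
        using N[OF that] by linarith
      then have "(2::real) ^ card T \<le> 2 ^ (l + (card T - card (N g)))"
        by (intro power_increasing) auto
      then show ?thesis
        using card_supersets[of T "N g"] N[OF that] assms(1) by (simp add: power_add)
    qed
    from sum_mono[of G, OF this] show ?thesis by simp
  qed
  also have "\<dots> = 2 ^ l * (\<Sum>g\<in>G. \<Sum>b\<in>Pow T. if N g \<subseteq> b then 1 else 0)"
    using assms(1) by (simp add: sum_distrib_left sum.If_cases Int_def)
  also have "(\<Sum>g\<in>G. \<Sum>b\<in>Pow T. if N g \<subseteq> b then 1 else 0) = (\<Sum>b\<in>Pow T. \<Sum>g\<in>G. if N g \<subseteq> b then 1 else (0::real))"
    by (rule sum.swap)
  also have "\<dots> = (\<Sum>b\<in>Pow T. real (card {g \<in> G. N g \<subseteq> b}))"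
    using assms(2) by (simp add: sum.If_cases Int_def)
  also have "\<dots> \<le> (\<Sum>b\<in>Pow T. \<Sum>j<p. real (card (out j (hist j b))))"
  proof (rule sum_mono)
    fix b assume "b \<in> Pow T"
    then have "card {g \<in> G. N g \<subseteq> b} = card (\<Union>j<p. out j (hist j b))"
      using correct by auto
    also have "\<dots> \<le> (\<Sum>j<p. card (out j (hist j b)))"
      by (rule card_UN_le) simp
    finally show "real (card {g \<in> G. N g \<subseteq> b}) \<le> (\<Sum>j<p. real (card (out j (hist j b))))"
      by (metis of_nat_le_iff of_nat_sum)
  qed
  also have "\<dots> = (\<Sum>j<p. \<Sum>b\<in>Pow T. real (card (out j (hist j b))))"
    by (rule sum.swap)
  also have "\<dots> \<le> (\<Sum>j<p. 2 ^ card T * (real (2 * B) powr \<rho> + C))"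
  proof (intro sum_mono total_output_le[OF assms(1,3,4) C _ out _ size])
    fix j b g assume "j \<in> {..<p}" "b \<subseteq> T" "g \<in> out j (hist j b)"
    then show "N g \<subseteq> b" using correct[of b] by blast
  qed (use hist in auto)
  finally have "real (card G) * 2 ^ card T \<le> (2 ^ l * real p * (real (2 * B) powr \<rho> + C)) * 2 ^ card T"
    by (simp add: mult_ac mult_left_mono)
  then show ?thesis by simp
qed

section \<open>The number of communication histories\<close>

lemma card_bounded_bit_strings: "card {s :: bool list. length s \<le> n} \<le> 4 ^ n"
proof -
  have "card {s :: bool list. length s \<le> n} = (\<Sum>i\<le>n. 2 ^ i)"
    using card_lists_length_le[of "UNIV :: bool set" n] by simp
  \<comment> \<open>A crude bound, but it is a pure power and equals 1 at \<open>n = 0\<close>, so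
    that load 0 leaves a single state.\<close>
  also have "\<dots> \<le> 4 ^ n"
  proof (induction n)
    case (Suc n)
    have "(2::nat) ^ n \<le> 4 ^ n" by (rule power_mono) simp_all
    then show ?case using Suc by simp
  qed simp
  finally show ?thesis .
qed

lemma received_le_load:
  assumes "k < r" and "j < p"
  shows "length (received A p D k j) \<le> load A p r D"
proof -
  have "finite {length (received A p D k j) | k j. k < r \<and> j < p}"
    by (rule finite_subset[of _ "(\<lambda>(k, j). length (received A p D k j)) ` ({..<r} \<times> {..<p})"]) auto
  then show ?thesis
    unfolding load_def using assms by (intro Max_ge) auto
qed

lemma history_bounded:
  assumes "load A p r D \<le> n" and "j < p"
  shows "history A p D r j \<in> {h. set h \<subseteq> {s. length s \<le> n} \<and> length h = r}"
proof -
  have "set (history A p D k j) \<subseteq> {s. length s \<le> n} \<and> length (history A p D k j) = k" if "k \<le> r" for k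
    using that
  proof (induction k)
    case (Suc k)
    have "length (received A p D k j) \<le> n"
      using received_le_load[of k r j p A D] Suc.prems assms by simp
    then show ?case
      using Suc by (simp add: received_def)
  qed simp
  then show ?thesis by simp
qed

text \<open>Supplies the bit count \<open>B\<close> of the counting argument. The placement may
  depend on the instance \<open>b\<close> in any way, because only the strings that can be received
  are counted.\<close>

lemma card_histories_le:
  assumes "\<And>b. b \<in> X \<Longrightarrow> load A p r (D b) \<le> n" and "j < p"
  shows "card ((\<lambda>b. history A p (D b) r j) ` X) \<le> 2 ^ (2 * n * r)"
proof -
  define Y where "Y = {s :: bool list. length s \<le> n}"
  have "finite Y"
    using finite_lists_length_le[of "UNIV :: bool set" n] by (simp add: Y_def)
  then have "card ((\<lambda>b. history A p (D b) r j) ` X) \<le> card {h. set h \<subseteq> Y \<and> length h = r}"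
    using history_bounded[OF assms(1,2)] by (intro card_mono finite_lists_length_eq) (auto simp: Y_def)
  also have "\<dots> = card Y ^ r"
    using \<open>finite Y\<close> by (rule card_lists_length_eq)
  also have "\<dots> \<le> (4 ^ n) ^ r"
    unfolding Y_def by (intro power_mono card_bounded_bit_strings) simp
  also have "\<dots> = 2 ^ (2 * n * r)"
    by (simp add: power_mult)
  finally show ?thesis .
qed

section \<open>Padded instances over a grid\<close>

definition answer_grid :: "('s, 'x) query \<Rightarrow> ('x \<Rightarrow> nat) \<Rightarrow> ('x \<Rightarrow> nat) set" where
  "answer_grid q n = PiE (set (head q)) (\<lambda>x. {..<n x})"

text \<open>The tag keeps equal tuples of different relations apart, as their presence is chosen
  independently.\<close>

definition facts :: "('s, 'x) query \<Rightarrow> ('x \<Rightarrow> nat) \<Rightarrow> ('s \<times> nat list) set" where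
  "facts q g = (\<lambda>(S, xs). (S, map g xs)) ` set (atoms q)"

text \<open>Values are taken from the top of the \<open>b\<close>-bit range: this separates padding
  from the small grid values and makes the first padding tuple force value width
  \<open>b\<close>.\<close>

definition padding :: "nat \<Rightarrow> nat \<Rightarrow> nat \<Rightarrow> nat list set" where
  "padding a b k = (\<lambda>i. replicate a (2 ^ b - Suc i)) ` {..<k}"

definition padded_relation :: "nat \<Rightarrow> nat \<Rightarrow> nat \<Rightarrow> nat list set \<Rightarrow> nat list set" where
  "padded_relation a b m R = R \<union> padding a b (m - card R)"

definition arity :: "('s, 'x) query \<Rightarrow> 's \<Rightarrow> nat" where
  "arity q S = length (the (map_of (atoms q) S))"

text \<open>Makes \<open>arity q S * width q b S\<close> the same for all relation names \<open>S\<close> of \<open>q\<close>.\<close>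

definition width :: "('s, 'x) query \<Rightarrow> nat \<Rightarrow> 's \<Rightarrow> nat" where
  "width q b S = b * (\<Prod>S' \<in> fst ` set (atoms q) - {S}. arity q S')"

definition padded_database ::
  "('s, 'x) query \<Rightarrow> nat \<Rightarrow> nat \<Rightarrow> ('s \<times> nat list) set \<Rightarrow> 's database" where
  "padded_database q b m Y = (\<lambda>S. if S \<in> fst ` set (atoms q)
     then padded_relation (arity q S) (width q b S) m {t. (S, t) \<in> Y} else {})"

text \<open>Counting down at most \<open>m\<close> steps from the top of a range of size at least
  \<open>2 * m\<close> stays in the part from \<open>m\<close> upwards.\<close>

lemma padding_value_ge:
  assumes "0 < a" and "2 * m \<le> 2 ^ b" and "k \<le> m" and "t \<in> padding a b k"
  shows "\<exists>v\<in>set t. m \<le> v"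
proof -
  obtain i where "t = replicate a (2 ^ b - Suc i)" and "i < k"
    using assms(4) unfolding padding_def by blast
  then show ?thesis
    using assms(1-3) by auto
qed

context
  fixes a b m :: nat and R :: "nat list set"
  assumes a: "0 < a" and b: "2 * m \<le> 2 ^ b"
    and R: "finite R" "card R < m" "\<And>t v. t \<in> R \<Longrightarrow> v \<in> set t \<Longrightarrow> v < m"
begin

lemma card_padding: "card (padding a b (m - card R)) = m - card R"
proof -
  have "inj_on (\<lambda>i. replicate a (2 ^ b - Suc i)) {..<m - card R}"
  proof (rule inj_onI)
    fix i j assume "i \<in> {..<m - card R}" "j \<in> {..<m - card R}"
      "replicate a ((2::nat) ^ b - Suc i) = replicate a (2 ^ b - Suc j)"
    moreover from this have "(2::nat) ^ b - Suc i = 2 ^ b - Suc j"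
      using a by (simp add: replicate_eq_replicate)
    ultimately show "i = j"
      using b by auto
  qed
  then show ?thesis
    by (simp add: padding_def card_image)
qed

lemma card_padded_relation: "card (padded_relation a b m R) = m"
proof -
  have "R \<inter> padding a b (m - card R) = {}"
    using padding_value_ge[OF a b diff_le_self] R(3) by (meson disjoint_iff linorder_not_le)
  moreover have "finite (padding a b (m - card R))"
    by (simp add: padding_def)
  ultimately show ?thesis
    using R by (simp add: padded_relation_def card_Un_disjoint card_padding)
qed

lemma value_width_padded_relation: "value_width (padded_relation a b m R) = b"
  unfolding value_width_def
proof (rule Least_equality)
  have "m \<le> 2 ^ b" using b by simp
  then show "\<forall>t\<in>padded_relation a b m R. \<forall>v\<in>set t. v < 2 ^ b"
    using R(3) by (fastforce simp: padded_relation_def padding_def)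
next
  fix c assume c: "\<forall>t\<in>padded_relation a b m R. \<forall>v\<in>set t. v < 2 ^ c"
  \<comment> \<open>As \<open>card R < m\<close> is strict, at least one padding tuple is present,
    and the first one carries the largest \<open>b\<close>-bit value.\<close>
  have "replicate a (2 ^ b - Suc 0) \<in> padded_relation a b m R"
    using R(2) by (auto simp: padded_relation_def padding_def)
  then have "2 ^ b - Suc 0 < 2 ^ c"
    using c a by force
  then have "(2::nat) ^ b \<le> 2 ^ c"
    by linarith
  then show "b \<le> c"
    by simp
qed

end

lemma mem_padded_relation_iff:
  assumes "0 < a" and "2 * m \<le> 2 ^ b" and "\<And>v. v \<in> set t \<Longrightarrow> v < m"
  shows "t \<in> padded_relation a b m R \<longleftrightarrow> t \<in> R"
proof -
  have "t \<notin> padding a b (m - card R)"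
    using padding_value_ge[OF assms(1,2) diff_le_self] assms(3) by (meson linorder_not_le)
  then show ?thesis
    by (simp add: padded_relation_def)
qed

text \<open>The strict bounds keep grid values below the padding values and leave room for a padding
  tuple in every relation.\<close>

locale gridded_query =
  fixes q :: "('s, 'x) query" and n :: "'x \<Rightarrow> nat" and b m :: nat
  assumes full: "full_conjunctive_query q" and sjf: "self_join_free q"
    and bits: "2 * m \<le> 2 ^ b"
    and n_less: "\<And>x. x \<in> set (head q) \<Longrightarrow> n x < m"
    and prod_less: "\<And>S xs. (S, xs) \<in> set (atoms q) \<Longrightarrow> (\<Prod>x\<in>set xs. n x) < m"
begin

abbreviation "grid \<equiv> answer_grid q n"

definition grid_facts :: "('s \<times> nat list) set" where
  "grid_facts = (\<Union>g\<in>grid. facts q g)"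

lemma arity_eq: "(S, xs) \<in> set (atoms q) \<Longrightarrow> arity q S = length xs"
  using sjf by (simp add: arity_def self_join_free_def)

lemma arity_pos: "S \<in> fst ` set (atoms q) \<Longrightarrow> 0 < arity q S"
  using arity_eq full by (fastforce simp: full_conjunctive_query_def)

lemma atom_unique: "(S, xs) \<in> set (atoms q) \<Longrightarrow> (S, ys) \<in> set (atoms q) \<Longrightarrow> xs = ys"
  using sjf by (metis self_join_free_def eq_key_imp_eq_value)

lemma atom_vars: "(S, xs) \<in> set (atoms q) \<Longrightarrow> set xs \<subseteq> set (head q)"
  using full by (auto simp: full_conjunctive_query_def)

lemma width_ge: "b \<le> width q b S"
proof -
  have "1 \<le> (\<Prod>S' \<in> fst ` set (atoms q) - {S}. arity q S')"
    using arity_pos by (intro prod_ge_1) (auto simp: Suc_le_eq)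
  then show ?thesis
    using mult_le_mono2[of 1 _ b] by (simp add: width_def)
qed

lemma bits_width: "2 * m \<le> 2 ^ width q b S"
  by (rule order_trans[OF bits power_increasing[OF width_ge]]) simp

lemma arity_mult_width:
  assumes "S \<in> fst ` set (atoms q)"
  shows "arity q S * width q b S = b * (\<Prod>S' \<in> fst ` set (atoms q). arity q S')"
  using assms prod.remove[of "fst ` set (atoms q)" S "arity q"] by (simp add: width_def)

lemma finite_grid: "finite grid"
  by (simp add: answer_grid_def finite_PiE)

lemma card_grid: "card grid = (\<Prod>x\<in>set (head q). n x)"
  by (simp add: answer_grid_def card_PiE)

lemma grid_value_less: "g \<in> grid \<Longrightarrow> x \<in> set (head q) \<Longrightarrow> g x < m"
  using n_less by (fastforce simp: answer_grid_def PiE_iff)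

lemma grid_eqI: "g \<in> grid \<Longrightarrow> h \<in> grid \<Longrightarrow> \<forall>x\<in>set (head q). g x = h x \<Longrightarrow> g = h"
  unfolding answer_grid_def by (rule PiE_ext) auto

lemma finite_grid_facts: "finite grid_facts"
  by (simp add: grid_facts_def facts_def finite_grid)

lemma facts_subset: "g \<in> grid \<Longrightarrow> facts q g \<subseteq> grid_facts"
  by (auto simp: grid_facts_def)

lemma card_facts_le: "card (facts q g) \<le> length (atoms q)"
  unfolding facts_def using card_image_le[OF finite_set] card_length by (rule order_trans)

lemma facts_nonempty: "facts q g \<noteq> {}"
  using full by (simp add: facts_def full_conjunctive_query_def)

context
  fixes S xs Y
  assumes atom: "(S, xs) \<in> set (atoms q)" and Y: "Y \<subseteq> grid_facts"
begin

lemma section_subset: "{t. (S, t) \<in> Y} \<subseteq> (\<lambda>g. map g xs) ` grid"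
proof
  fix t assume "t \<in> {t. (S, t) \<in> Y}"
  then obtain g ys where "g \<in> grid" "(S, ys) \<in> set (atoms q)" "t = map g ys"
    using Y by (auto simp: grid_facts_def facts_def)
  then show "t \<in> (\<lambda>g. map g xs) ` grid"
    using atom_unique[OF atom] by blast
qed

lemma section_finite: "finite {t. (S, t) \<in> Y}"
  using section_subset finite_grid by (metis finite_imageI finite_subset)

lemma section_card: "card {t. (S, t) \<in> Y} < m"
proof -
  \<comment> \<open>Only the variables of the atom matter for its tuples; restricting to them
    replaces the size of the whole grid by the product over \<open>xs\<close>.\<close>
  have "(\<lambda>g. map g xs) ` grid \<subseteq> (\<lambda>g. map g xs) ` PiE (set xs) (\<lambda>x. {..<n x})"
  proof
    fix t assume "t \<in> (\<lambda>g. map g xs) ` grid"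
    then obtain g where "g \<in> grid" "t = map g xs" by blast
    then have "t = map (restrict g (set xs)) xs" "restrict g (set xs) \<in> PiE (set xs) (\<lambda>x. {..<n x})"
      using atom_vars[OF atom] by (auto simp: answer_grid_def)
    then show "t \<in> (\<lambda>g. map g xs) ` PiE (set xs) (\<lambda>x. {..<n x})" by blast
  qed
  with section_subset have "{t. (S, t) \<in> Y} \<subseteq> (\<lambda>g. map g xs) ` PiE (set xs) (\<lambda>x. {..<n x})"
    by (rule order_trans)
  then have "card {t. (S, t) \<in> Y} \<le> card (PiE (set xs) (\<lambda>x. {..<n x}))"
    by (intro surj_card_le finite_PiE) auto
  also have "\<dots> = (\<Prod>x\<in>set xs. n x)"
    by (simp add: card_PiE)
  also have "\<dots> < m"
    using prod_less[OF atom] .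
  finally show ?thesis .
qed

lemma section_value: "t \<in> {t. (S, t) \<in> Y} \<Longrightarrow> v \<in> set t \<Longrightarrow> v < m"
  using section_subset grid_value_less atom_vars[OF atom] by fastforce

lemma padded_database_atom:
  "padded_database q b m Y S = padded_relation (length xs) (width q b S) m {t. (S, t) \<in> Y}"
  using atom arity_eq[OF atom] by (force simp: padded_database_def)

lemma card_padded_database: "card (padded_database q b m Y S) = m"
  unfolding padded_database_atom
  using section_finite section_card section_value bits_width arity_pos[of S] arity_eq[OF atom] atom
  by (intro card_padded_relation) force+

lemma size_padded_database:
  "size_in_bits (length xs) (padded_database q b m Y S)
    = m * (b * (\<Prod>S' \<in> fst ` set (atoms q). arity q S'))"
proof -
  have S: "S \<in> fst ` set (atoms q)" using atom by force
  have "value_width (padded_database q b m Y S) = width q b S"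
    unfolding padded_database_atom
    using section_finite section_card section_value bits_width arity_pos[OF S] arity_eq[OF atom]
    by (intro value_width_padded_relation) auto
  then show ?thesis
    using arity_mult_width[OF S] arity_eq[OF atom]
    by (simp add: size_in_bits_def card_padded_database mult.left_commute)
qed

lemma mem_padded_database_iff:
  assumes "g \<in> grid"
  shows "map g xs \<in> padded_database q b m Y S \<longleftrightarrow> (S, map g xs) \<in> Y"
proof -
  have "0 < length xs"
    using atom full by (fastforce simp: full_conjunctive_query_def)
  moreover have "v < m" if "v \<in> set (map g xs)" for v
    using that grid_value_less[OF assms] atom_vars[OF atom] by auto
  ultimately show ?thesis
    unfolding padded_database_atom by (subst mem_padded_relation_iff) (auto intro: bits_width)
qed

end

lemma database_for_padded_database:
  assumes "Y \<subseteq> grid_facts"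
  shows "database_for q (padded_database q b m Y)"
  unfolding database_for_def
proof (intro conjI allI impI)
  have "length t = length xs" if "(S, xs) \<in> set (atoms q)" "t \<in> padded_database q b m Y S" for S xs t
    using that section_subset[OF that(1) assms]
    by (auto simp: padded_database_atom[OF that(1) assms] padded_relation_def padding_def)
  moreover have "finite (padded_database q b m Y S)" if "(S, xs) \<in> set (atoms q)" for S xs
    using section_finite[OF that assms]
    by (simp add: padded_database_atom[OF that assms] padded_relation_def padding_def)
  ultimately show "\<forall>(S, xs)\<in>set (atoms q). finite (padded_database q b m Y S) \<and>
      (\<forall>t\<in>padded_database q b m Y S. length t = length xs)"
    by blast
qed (auto simp: padded_database_def)

text \<open>By fullness the head tuple fixes the valuation on all body variables, and padding tuples
  cannot match grid values. Padding may create further answers, but none of them lies on the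
  grid.\<close>

lemma mem_answers_iff:
  assumes "g \<in> grid" and "Y \<subseteq> grid_facts"
  shows "map g (head q) \<in> answers q (padded_database q b m Y) \<longleftrightarrow> facts q g \<subseteq> Y"
proof -
  have "map g (head q) \<in> answers q (padded_database q b m Y)
      \<longleftrightarrow> (\<forall>(S, xs)\<in>set (atoms q). map g xs \<in> padded_database q b m Y S)" (is "_ \<longleftrightarrow> ?R")
  proof
    assume "map g (head q) \<in> answers q (padded_database q b m Y)"
    then obtain \<alpha> where \<alpha>: "map g (head q) = map \<alpha> (head q)"
        "\<forall>(S, xs)\<in>set (atoms q). map \<alpha> xs \<in> padded_database q b m Y S"
      unfolding answers_def by blast
    have "map g xs \<in> padded_database q b m Y S" if "(S, xs) \<in> set (atoms q)" for S xs
    proof -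
      have eq: "map g xs = map \<alpha> xs"
        using \<alpha>(1) atom_vars[OF that] by auto
      show ?thesis
        using bspec[OF \<alpha>(2) that] by (simp only: eq prod.case)
    qed
    then show ?R by auto
  qed (auto simp: answers_def)
  also have "\<dots> \<longleftrightarrow> facts q g \<subseteq> Y"
    using mem_padded_database_iff[OF _ assms(2,1)] by (fastforce simp: facts_def)
  finally show ?thesis .
qed

text \<open>The AGM bound with every projection estimated by the total number of facts. It holds for
  each cover; taking logarithms allows passing to the infimum of the weights.\<close>

lemma card_le_facts_powr:
  assumes "Q \<subseteq> grid"
  shows "real (card Q) \<le> real (card (\<Union>g\<in>Q. facts q g)) powr fractional_edge_cover_number q"
proof (cases "Q = {}")
  case False
  define K where "K = card (\<Union>g\<in>Q. facts q g)"
  have finQ: "finite Q"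
    using assms finite_grid by (rule finite_subset)
  have fin: "finite (\<Union>g\<in>Q. facts q g)"
    using finQ by (simp add: facts_def)
  have "(\<Union>g\<in>Q. facts q g) \<noteq> {}"
    using False facts_nonempty by blast
  then have K: "0 < K"
    using fin by (simp add: K_def card_gt_0_iff)
  have Q0: "0 < card Q"
    using False finQ by (simp add: card_gt_0_iff)
  have bound: "real (card Q) \<le> real K powr (\<Sum>(S, xs)\<in>set (atoms q). w S)"
    if w: "fractional_edge_cover q w" for w
  proof -
    have "real (card Q) \<le> (\<Prod>i\<in>set (atoms q). real (card ((\<lambda>g. map g (snd i)) ` Q)) powr w (fst i))"
    proof (rule AGM_bound[of "set (head q)"])
      show "1 \<le> (\<Sum>i | i \<in> set (atoms q) \<and> x \<in> set (snd i). w (fst i))" if "x \<in> set (head q)" for x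
        using w that by (auto simp: fractional_edge_cover_def case_prod_unfold)
      show "g = h" if "g \<in> Q" "h \<in> Q" "\<forall>x\<in>set (head q). g x = h x" for g h
        using grid_eqI that assms by blast
    qed (use w finQ False in \<open>auto simp: fractional_edge_cover_def\<close>)
    also have "\<dots> \<le> (\<Prod>i\<in>set (atoms q). real K powr w (fst i))"
    proof (intro prod_mono conjI powr_mono2)
      fix i assume i: "i \<in> set (atoms q)"
      \<comment> \<open>Tagging with the relation name embeds the projection to one atom into the
        set of all facts.\<close>
      have "Pair (fst i) ` (\<lambda>g. map g (snd i)) ` Q \<subseteq> (\<Union>g\<in>Q. facts q g)"
        using i by (force simp: facts_def)
      then have "card (Pair (fst i) ` (\<lambda>g. map g (snd i)) ` Q) \<le> K"
        unfolding K_def using fin by (rule card_mono[rotated])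
      then show "real (card ((\<lambda>g. map g (snd i)) ` Q)) \<le> real K"
        by (simp add: card_image inj_on_def)
      show "0 \<le> w (fst i)"
        using w i by (auto simp: fractional_edge_cover_def)
    qed auto
    also have "\<dots> = real K powr (\<Sum>(S, xs)\<in>set (atoms q). w S)"
      using K by (simp add: powr_sum case_prod_unfold)
    finally show ?thesis .
  qed
  show ?thesis
  \<comment> \<open>Base 1 has no usable logarithm, but then every power of \<open>K\<close> is 1
    and any cover gives the claim.\<close>
  proof (cases "K = 1")
    case True
    then show ?thesis
      using bound[OF fractional_edge_cover_1[OF full]] by (simp add: K_def)
  next
    case False
    then have K1: "1 < real K" using K by simp
    have "log (real K) (real (card Q)) \<le> fractional_edge_cover_number q"
      unfolding fractional_edge_cover_number_def
    proof (rule cInf_greatest)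
      fix y assume "y \<in> {(\<Sum>(S, xs)\<in>set (atoms q). w S) | w. fractional_edge_cover q w}"
      then obtain w where "y = (\<Sum>(S, xs)\<in>set (atoms q). w S)" "fractional_edge_cover q w" by blast
      then show "log (real K) (real (card Q)) \<le> y"
        using bound[of w] K1 Q0 by (simp add: log_le_iff)
    qed (use fractional_edge_cover_1[OF full] in blast)
    then show ?thesis
      using K1 Q0 by (simp add: log_le_iff K_def)
  qed
qed simp

text \<open>Transfers the abstract counting to an algorithm, with the complete history of a server
  as its state. Positivity of \<open>L\<close> is established too, because it later lets the
  additive constant \<open>C\<close> be absorbed into a power of \<open>L\<close>.\<close>

lemma computation_bound:
  fixes A :: "'s mpc_algorithm" and D :: "'s database \<Rightarrow> nat \<Rightarrow> 's database"
  assumes computes: "\<And>Y. Y \<subseteq> grid_facts \<Longrightarrow>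
      computes A p r q (padded_database q b m Y) (D (padded_database q b m Y))"
    and load: "\<And>Y. Y \<subseteq> grid_facts \<Longrightarrow> load A p r (D (padded_database q b m Y)) \<le> L"
    and "grid \<noteq> {}" and "0 < C"
    and C: "\<And>k::nat. real k powr fractional_edge_cover_number q \<le> C * 2 powr (real k / 2)"
  shows "0 < L" and "real (card grid) \<le>
    2 ^ length (atoms q) * real p * (real (2 * (2 * L * r)) powr fractional_edge_cover_number q + C)"
proof -
  define hist where "hist j Y = history A p (D (padded_database q b m Y)) r j" for j Y
  \<comment> \<open>Discarding outputs outside the grid removes the answers that arise from
    padding.\<close>
  define out where "out j h = {g \<in> grid. map g (head q) \<in> result A j h}" for j h
  have correct: "(\<Union>j<p. out j (hist j Y)) = {g \<in> grid. facts q g \<subseteq> Y}" if "Y \<subseteq> grid_facts" for Y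
  proof -
    have "(\<Union>j<p. out j (hist j Y)) = {g \<in> grid. map g (head q) \<in> (\<Union>j<p. result A j (hist j Y))}"
      by (auto simp: out_def)
    also have "(\<Union>j<p. result A j (hist j Y)) = answers q (padded_database q b m Y)"
      using computes[OF that] by (simp add: computes_def hist_def)
    also have "{g \<in> grid. map g (head q) \<in> answers q (padded_database q b m Y)} = {g \<in> grid. facts q g \<subseteq> Y}"
      by (intro Collect_cong conj_cong refl mem_answers_iff that)
    finally show ?thesis .
  qed
  have hist: "card (hist j ` Pow grid_facts) \<le> 2 ^ (2 * L * r)" if "j < p" for j
    unfolding hist_def by (rule card_histories_le) (use load that in auto)
  show "0 < L"
  proof (rule ccontr)
    assume "\<not> 0 < L"
    obtain g where g: "g \<in> grid" using \<open>grid \<noteq> {}\<close> by blast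
    then have "g \<in> (\<Union>j<p. out j (hist j grid_facts))"
      using correct[of grid_facts] facts_subset by blast
    then obtain j where j: "j < p" "g \<in> out j (hist j grid_facts)"
      by blast
    \<comment> \<open>With load 0 a server is in the same state on the full and on the empty set of
      facts, yet \<open>g\<close> is an answer only for the former.\<close>
    have "card (hist j ` Pow grid_facts) \<le> Suc 0"
      using hist[OF j(1)] \<open>\<not> 0 < L\<close> by simp
    then have "hist j grid_facts = hist j {}"
      using finite_grid_facts by (subst (asm) card_le_Suc0_iff_eq) auto
    then have "g \<in> (\<Union>j<p. out j (hist j {}))"
      using j by (metis UN_I lessThan_iff)
    then show False
      unfolding correct[OF empty_subsetI] using facts_nonempty[of g] by simp
  qed
  show "real (card grid) \<le>
    2 ^ length (atoms q) * real p * (real (2 * (2 * L * r)) powr fractional_edge_cover_number q + C)"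
  proof (rule distributed_output_bound[OF finite_grid_facts finite_grid \<open>0 < C\<close> _ C _ hist _ correct])
    show "0 \<le> fractional_edge_cover_number q"
      using fractional_edge_cover_number_ge_1[OF full] by simp
    show "facts q g \<subseteq> grid_facts \<and> card (facts q g) \<le> length (atoms q)" if "g \<in> grid" for g
      using facts_subset[OF that] card_facts_le by simp
    show "out j h \<subseteq> grid" for j h
      by (auto simp: out_def)
  qed (use card_le_facts_powr in auto)
qed

end

section \<open>The lower bound\<close>

text \<open>An algorithm may have the answers of a single instance hard-wired, so the bound concerns
  the worst load over \<open>F m\<close>. The constant is fixed before \<open>m\<close>,
  \<open>p\<close>, the placement and the algorithm.\<close>

theorem theorem4p1:
  fixes q :: "('s, 'x) query"
  assumes "full_conjunctive_query q" and "self_join_free q"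
  shows "\<exists>(F :: nat \<Rightarrow> 's database set) (M :: nat \<Rightarrow> nat).
    (\<forall>m. \<forall>I \<in> F m. database_for q I \<and>
       (\<forall>(S, xs) \<in> set (atoms q). card (I S) = m \<and> size_in_bits (length xs) (I S) = M m)) \<and>
    (\<forall>r\<ge>1. \<exists>c>0. \<exists>m0. \<forall>m\<ge>m0. \<forall>p\<ge>1.
       \<forall>(D :: 's database \<Rightarrow> nat \<Rightarrow> 's database) (A :: 's mpc_algorithm).
         (\<forall>I \<in> F m. even_partition q p I (D I)) \<longrightarrow>
         (\<forall>I \<in> F m. computes A p r q I (D I)) \<longrightarrow>
         (\<exists>I \<in> F m. real (load A p r (D I))
            \<ge> c * real m / real p powr (1 / fractional_edge_cover_number q)))"
proof -
  define \<rho> where "\<rho> = fractional_edge_cover_number q"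
  have \<rho>: "1 \<le> \<rho>"
    unfolding \<rho>_def by (rule fractional_edge_cover_number_ge_1[OF assms(1)])
  define h where "h = card (set (head q))"
  define bits where "bits m = (LEAST b. 2 * m \<le> 2 ^ b)" for m :: nat
  have bits: "2 * m \<le> 2 ^ bits m" for m
    unfolding bits_def by (rule LeastI[of _ "2 * m"]) (simp add: less_imp_le less_exp)
  \<comment> \<open>The grid is built for \<open>m - 1\<close> in place of \<open>m\<close>, which
    gives the strict bounds of \<open>gridded_query\<close>; \<open>4 \<le> m\<close> provides
    \<open>3 \<le> m - 1\<close>.\<close>
  have "\<forall>m\<ge>4. \<exists>n. (\<forall>x\<in>set (head q). n x \<le> m - 1) \<and>
      (\<forall>(S, xs)\<in>set (atoms q). (\<Prod>x\<in>set xs. n x) \<le> m - 1) \<and>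
      real (m - 1) powr \<rho> \<le> 2 * 2 ^ h * real (\<Prod>x\<in>set (head q). n x)"
    unfolding \<rho>_def h_def using assms by (intro allI impI grid_sizes_exist) auto
  then obtain n where n: "\<And>m. 4 \<le> m \<Longrightarrow> (\<forall>x\<in>set (head q). n m x \<le> m - 1) \<and>
      (\<forall>(S, xs)\<in>set (atoms q). (\<Prod>x\<in>set xs. n m x) \<le> m - 1) \<and>
      real (m - 1) powr \<rho> \<le> 2 * 2 ^ h * real (\<Prod>x\<in>set (head q). n m x)"
    by metis
  have gridded: "gridded_query q (n m) (bits m) m" if m: "4 \<le> m" for m
  proof
    show "n m x < m" if "x \<in> set (head q)" for x
      using n[OF m] that m by fastforce
    show "(\<Prod>x\<in>set xs. n m x) < m" if "(S, xs) \<in> set (atoms q)" for S xs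
      using n[OF m] that m by fastforce
  qed (use assms bits in auto)
  define T where "T m = gridded_query.grid_facts q (n m)" for m
  \<comment> \<open>For \<open>m < 4\<close> no grid is available; the size claims then hold
    vacuously, and \<open>m0 = 4\<close> excludes these \<open>m\<close> from the lower
    bound.\<close>
  define F where "F m = (if m < 4 then {} else padded_database q (bits m) m ` Pow (T m))" for m
  define M where "M m = m * (bits m * (\<Prod>S \<in> fst ` set (atoms q). arity q S))" for m
  have "\<forall>m. \<forall>I \<in> F m. database_for q I \<and>
      (\<forall>(S, xs) \<in> set (atoms q). card (I S) = m \<and> size_in_bits (length xs) (I S) = M m)"
  proof (intro allI ballI)
    fix m I
    assume "I \<in> F m"
    then have "4 \<le> m" and "I \<in> padded_database q (bits m) m ` Pow (T m)"
      by (auto simp: F_def split: if_splits)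
    then obtain Y where Y: "Y \<subseteq> T m" and I: "I = padded_database q (bits m) m Y"
      by blast
    interpret gridded_query q "n m" "bits m" m
      by (rule gridded) fact
    show "database_for q I \<and>
        (\<forall>(S, xs) \<in> set (atoms q). card (I S) = m \<and> size_in_bits (length xs) (I S) = M m)"
      using database_for_padded_database[OF Y[unfolded T_def]]
        card_padded_database[OF _ Y[unfolded T_def]] size_padded_database[OF _ Y[unfolded T_def]]
      unfolding I M_def by auto
  qed
  moreover have "\<forall>r\<ge>1. \<exists>c>0. \<exists>m0. \<forall>m\<ge>m0. \<forall>p\<ge>1.
       \<forall>(D :: 's database \<Rightarrow> nat \<Rightarrow> 's database) (A :: 's mpc_algorithm).
         (\<forall>I \<in> F m. even_partition q p I (D I)) \<longrightarrow>
         (\<forall>I \<in> F m. computes A p r q I (D I)) \<longrightarrow>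
         (\<exists>I \<in> F m. real (load A p r (D I)) \<ge> c * real m / real p powr (1 / \<rho>))"
  proof (intro allI impI)
    fix r :: nat
    obtain C where "0 < C" and C: "\<And>k::nat. real k powr \<rho> \<le> C * 2 powr (real k / 2)"
      using powr_le_exponential[of \<rho>] \<rho> by auto
    \<comment> \<open>The factors come from the rounding of the grid, from the chance that all facts
      of an answer are present, and from the average output of one server.\<close>
    define E where "E = 2 * 2 ^ h * 2 ^ length (atoms q) * (real (4 * r) powr \<rho> + C)"
    have E: "0 < E"
      using \<open>0 < C\<close> by (simp add: E_def add_nonneg_pos)
    show "\<exists>c>0. \<exists>m0. \<forall>m\<ge>m0. \<forall>p\<ge>1.
       \<forall>(D :: 's database \<Rightarrow> nat \<Rightarrow> 's database) (A :: 's mpc_algorithm).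
         (\<forall>I \<in> F m. even_partition q p I (D I)) \<longrightarrow>
         (\<forall>I \<in> F m. computes A p r q I (D I)) \<longrightarrow>
         (\<exists>I \<in> F m. real (load A p r (D I)) \<ge> c * real m / real p powr (1 / \<rho>))"
    \<comment> \<open>The root of \<open>E\<close> arises from solving for the load, the extra 2
      from \<open>m \<le> 2 * (m - 1)\<close>.\<close>
    proof (intro exI[of _ "1 / (2 * E powr (1 / \<rho>))"] exI[of _ 4] conjI allI impI)
      fix m p :: nat and D :: "'s database \<Rightarrow> nat \<Rightarrow> 's database" and A :: "'s mpc_algorithm"
      assume m: "4 \<le> m" and p: "1 \<le> p" and "\<forall>I\<in>F m. even_partition q p I (D I)"
        and comp: "\<forall>I\<in>F m. computes A p r q I (D I)"
      interpret gridded_query q "n m" "bits m" m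
        using m by (rule gridded)
      have F: "F m = padded_database q (bits m) m ` Pow grid_facts"
        using m by (simp add: F_def T_def)
      have finF: "finite (F m)"
        unfolding F using finite_grid_facts by simp
      \<comment> \<open>A worst instance makes its load \<open>L\<close> a common bound for all
        instances of \<open>F m\<close>, as the counting requires.\<close>
      obtain I where I: "I \<in> F m" and max: "\<And>J. J \<in> F m \<Longrightarrow> load A p r (D J) \<le> load A p r (D I)"
      proof -
        have "Max ((\<lambda>J. load A p r (D J)) ` F m) \<in> (\<lambda>J. load A p r (D J)) ` F m"
          using finF by (intro Max_in) (auto simp: F)
        then obtain I where "I \<in> F m" "load A p r (D I) = Max ((\<lambda>J. load A p r (D J)) ` F m)"
          by auto
        then show ?thesis
          using that finF by simp
      qed
      define L where "L = load A p r (D I)"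
      have card_ge: "real (m - 1) powr \<rho> \<le> 2 * 2 ^ h * real (card grid)"
        using n[OF m] by (simp add: card_grid)
      then have "grid \<noteq> {}"
        using m by auto
      have "0 < L" and card_le:
        "real (card grid) \<le> 2 ^ length (atoms q) * real p * (real (2 * (2 * L * r)) powr \<rho> + C)"
        using computation_bound[of A p r D L C] comp max \<open>grid \<noteq> {}\<close> \<open>0 < C\<close> C
        unfolding F L_def \<rho>_def by auto
      have "1 \<le> real L powr \<rho>"
        using \<open>0 < L\<close> \<rho> by (simp add: ge_one_powr_ge_zero)
      then have "C \<le> C * real L powr \<rho>"
        using \<open>0 < C\<close> by simp
      moreover have "real (2 * (2 * L * r)) powr \<rho> = real L powr \<rho> * real (4 * r) powr \<rho>"
        by (simp add: powr_mult[symmetric] mult_ac)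
      ultimately have LC: "real (2 * (2 * L * r)) powr \<rho> + C
          \<le> real L powr \<rho> * (real (4 * r) powr \<rho> + C)"
        by (simp add: algebra_simps)
      have "real (m - 1) powr \<rho> \<le> 2 * 2 ^ h * (2 ^ length (atoms q) * real p *
          (real L powr \<rho> * (real (4 * r) powr \<rho> + C)))"
        using order_trans[OF card_le mult_left_mono[OF LC]]
        by (intro order_trans[OF card_ge] mult_left_mono) auto
      also have "\<dots> = E * real p * real L powr \<rho>"
        by (simp add: E_def mult_ac)
      \<comment> \<open>Taking the \<open>\<rho>\<close>-th root turns the dependence on
        \<open>p\<close> into \<open>p powr (1 / \<rho>)\<close> and makes the bound linear in
        \<open>L\<close>.\<close>
      finally have "(real (m - 1) powr \<rho>) powr (1 / \<rho>) \<le> (E * real p * real L powr \<rho>) powr (1 / \<rho>)"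
        using \<rho> by (intro powr_mono2) auto
      moreover have "(E * real p * real L powr \<rho>) powr (1 / \<rho>)
          = E powr (1 / \<rho>) * real p powr (1 / \<rho>) * real L"
        using E \<rho> by (simp add: powr_mult powr_powr)
      ultimately have "real (m - 1) \<le> E powr (1 / \<rho>) * real p powr (1 / \<rho>) * real L"
        using \<rho> by (simp add: powr_powr)
      moreover have "real m \<le> 2 * real (m - 1)"
        using m by simp
      ultimately have "real m \<le> 2 * (E powr (1 / \<rho>) * real p powr (1 / \<rho>) * real L)"
        by linarith
      then have "1 / (2 * E powr (1 / \<rho>)) * real m / real p powr (1 / \<rho>) \<le> real L"
        using E p by (simp add: field_simps)
      then show "\<exists>I\<in>F m. 1 / (2 * E powr (1 / \<rho>)) * real m / real p powr (1 / \<rho>) \<le> real (load A p r (D I))"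
        using I unfolding L_def by blast
    qed (use E in simp)
  qed
  ultimately show ?thesis
    unfolding \<rho>_def by (intro exI[of _ F] exI[of _ M] conjI)
qed

end
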